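(* Let $\varepsilon_0$ denote the infimum of all $\varepsilon>0$ having the finite rotation property. Then $\varepsilon_0\le\frac15$.
   Context: For real $x$, $\|x\|$ denotes the distance from $x$ to the nearest integer. For $\varepsilon>0$, $E_{\varepsilon}=\{(x,y)\in\mathbb{R}^2:\|x\|\le\varepsilon\}$. $R_{\theta}$ denotes the counterclockwise rotation of the plane $\mathbb{R}^2$ by angle $\theta$ around the origin. A real number $\varepsilon>0$ has the finite rotation property if there exist finitely many angles $\theta_0,\dots,\theta_n$ such that $\mathbb{R}^2=\bigcup_{j=0}^{n}R_{\theta_j}E_{\varepsilon}$. *)

theory Defs
  imports "HOL-Analysis.Analysis"
begin

definition dist_nearest_int :: "real \<Rightarrow> real" where
  "dist_nearest_int x = \<bar>x - of_int (round x)\<bar>"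

definition strips :: "real \<Rightarrow> (real \<times> real) set" where
  "strips \<epsilon> = {(x, y). dist_nearest_int x \<le> \<epsilon>}"

definition rotation :: "real \<Rightarrow> real \<times> real \<Rightarrow> real \<times> real" where
  "rotation \<theta> = (\<lambda>(x, y). (cos \<theta> * x - sin \<theta> * y, sin \<theta> * x + cos \<theta> * y))"

definition finite_rotation_property :: "real \<Rightarrow> bool" where
  "finite_rotation_property \<epsilon> \<longleftrightarrow>
    (\<exists>(n::nat) (\<theta>::nat \<Rightarrow> real). (UNIV :: (real \<times> real) set) = (\<Union>j\<in>{0..n}. rotation (\<theta> j) ` strips \<epsilon>))"

(* The set below is bounded below by 0 and contains 1/2 (as strips (1/2) is the whole plane),
   so the real-valued Inf is a genuine infimum. *)
definition epsilon0 :: real where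
  "epsilon0 = Inf {\<epsilon>. 0 < \<epsilon> \<and> finite_rotation_property \<epsilon>}"

end

(* Suppose all the unit vectors v needed below have the distance of v.z to the nearest integer
   greater than 1/5. Let w = exp(2 pi i/3). A unit vector u gives the "frame" c = (u.z/7, (wu).z/7),
   and the numbers v.z for the 18 unit vectors v in (u/7)Z[w] are integral linear forms in c, so only
   c modulo Z^2 matters. Up to the 12 symmetries of the hexagonal lattice, c must lie in one of five
   tiny polygons, located at the torsion points of orders 3, 4 and 9 and at two accidental places.
   Now u1 - u2 is again a unit vector after multiplication by sqrt(-3) (the Moser spindle), or by 2,
   for a suitable rotation u2 of u1, so the frame c3 of the third vector is sqrt(-3)(c1 - c2), resp.
   2(c1 - c2). Running through the possible polygons of c1 and c2 and testing the 18 forms on c3, one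
   eliminates the five polygons one after the other. *)

theory Submission
  imports Defs
begin

section \<open>Integral linear forms that avoid the integers\<close>

definition avoids :: "real \<Rightarrow> bool" where
  "avoids t \<longleftrightarrow> 1 / 5 < dist_nearest_int t"

lemma dist_nearest_int_le: "dist_nearest_int t \<le> \<bar>t - of_int m\<bar>"
  using round_diff_minimal[of t m] by (simp add: dist_nearest_int_def abs_minus_commute)

text \<open>\<open>round t\<close> is a nearest integer, so every other integer \<open>m\<close> is
  also more than 1/5 away from \<open>t\<close>. Multiplying by 5 keeps the constants of all later
  inequalities integral.\<close>

lemma avoids_cases:
  assumes "avoids t"
  shows "5 * t < of_int (5 * m - 1) \<or> of_int (5 * m + 1) < 5 * t"
  using assms dist_nearest_int_le[of t m] by (auto simp: avoids_def abs_if split: if_splits)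

lemma dist_nearest_int_add_le: "dist_nearest_int (t + of_int m) \<le> dist_nearest_int t"
  using dist_nearest_int_le[of "t + of_int m" "round t + m"]
  by (simp add: dist_nearest_int_def)

lemma dist_nearest_int_minus_le: "dist_nearest_int (- t) \<le> dist_nearest_int t"
  using dist_nearest_int_le[of "- t" "- round t"]
  by (simp add: dist_nearest_int_def abs_minus_commute)

lemma avoids_add_int: "avoids (t + of_int m) \<Longrightarrow> avoids t"
  using dist_nearest_int_add_le[of t m] by (simp add: avoids_def)

lemma avoids_uminus: "avoids (- t) \<Longrightarrow> avoids t"
  using dist_nearest_int_minus_le[of t] by (simp add: avoids_def)

section \<open>Integral forms and matrices on the plane, and their effect on integer points\<close>

type_synonym mat = "int \<times> int \<times> int \<times> int"

fun form :: "int \<times> int \<Rightarrow> real \<times> real \<Rightarrow> real" where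
  "form (p, q) (x, y) = of_int p * x + of_int q * y"

fun app :: "mat \<Rightarrow> real \<times> real \<Rightarrow> real \<times> real" where
  "app (a, b, c, d) (x, y) = (of_int a * x + of_int b * y, of_int c * x + of_int d * y)"

fun mat_mul :: "mat \<Rightarrow> mat \<Rightarrow> mat" where
  "mat_mul (a, b, c, d) (a', b', c', d') =
    (a * a' + b * c', a * b' + b * d', c * a' + d * c', c * b' + d * d')"

fun row_mul :: "int \<times> int \<Rightarrow> mat \<Rightarrow> int \<times> int" where
  "row_mul (p, q) (a, b, c, d) = (p * a + q * c, p * b + q * d)"

lemma form_row_mul: "form (row_mul u A) v = form u (app A v)"
  by (cases u; cases A; cases v) (simp add: algebra_simps)

lemma app_mat_mul: "app (mat_mul A B) v = app A (app B v)"
  by (cases A; cases B; cases v) (simp add: algebra_simps)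

lemma form_add: "form u (v + w) = form u v + form u w"
  by (cases u; cases v; cases w) (simp add: algebra_simps)

lemma form_diff: "form u (v - w) = form u v - form u w"
  by (cases u; cases v; cases w) (simp add: algebra_simps)

lemma form_uminus: "form (- u) v = - form u v"
  by (cases u; cases v) (simp add: algebra_simps)

lemma app_add: "app A (v + w) = app A v + app A w"
  by (cases A; cases v; cases w) (simp add: algebra_simps)

lemma app_diff: "app A (v - w) = app A v - app A w"
  by (cases A; cases v; cases w) (simp add: algebra_simps)

fun int_pt :: "int \<times> int \<Rightarrow> real \<times> real" where
  "int_pt (m, n) = (of_int m, of_int n)"

lemma form_int_pt: "\<exists>k. form u (int_pt m) = of_int k"
  by (cases u; cases m) (metis form.simps int_pt.simps of_int_add of_int_mult)

lemma app_int_pt: "\<exists>k. app A (int_pt m) = int_pt k"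
  by (cases A; cases m) (auto intro!: exI simp flip: of_int_mult of_int_add)

lemma int_pt_add: "\<exists>k. int_pt m + int_pt n = int_pt k"
  by (cases m; cases n) (auto intro!: exI simp flip: of_int_add)

text \<open>The pair \<open>(p, q)\<close> stands for \<open>p + q\<omega>\<close>; these are the elements of norm 49, up to sign.\<close>

definition norm49 :: "(int \<times> int) list" where
  "norm49 = [(7,0), (0,7), (7,7), (3,-5), (3,8), (8,3), (5,8), (8,5), (5,-3)]"

definition good :: "real \<times> real \<Rightarrow> bool" where
  "good v \<longleftrightarrow> (\<forall>u\<in>set norm49. avoids (form u v))"

lemma good_add_int: "good (v + int_pt m) \<Longrightarrow> good v"
  unfolding good_def form_add by (metis avoids_add_int form_int_pt)

section \<open>Reduction to a fundamental triangle\<close>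

text \<open>The powers of \<open>(1, 1, -1, 0)\<close>, which is multiplication by \<open>1 + \<omega>\<close>, and their products
  with the coordinate swap.\<close>

definition hex_group :: "mat list" where
  "hex_group =
    [(1,0,0,1), (1,1,-1,0), (0,1,-1,-1), (-1,0,0,-1), (-1,-1,1,0), (0,-1,1,1), (0,1,1,0),
    (1,1,0,-1), (1,0,-1,-1), (0,-1,-1,0), (-1,-1,0,1), (-1,0,1,1)]"

lemma hex_group_mul: "\<forall>g\<in>set hex_group. \<forall>h\<in>set hex_group. mat_mul g h \<in> set hex_group"
  by code_simp

text \<open>Takes the place of inverses: two symmetries \<open>g\<close> and \<open>h\<close> enter
  later only through the relative symmetry \<open>k\<close>, so a pair of polygons needs 12
  certificates and not 144.\<close>

lemma hex_group_quotient:
  "\<forall>g\<in>set hex_group. \<forall>h\<in>set hex_group. \<exists>k\<in>set hex_group. h = mat_mul g k"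
  by code_simp

text \<open>The matrices are symmetries of the hexagonal lattice, so on rows they permute the
  elements of norm 49, up to the sign that \<open>norm49\<close> leaves out.\<close>

lemma hex_group_norm49:
  "\<forall>g\<in>set hex_group. \<forall>u\<in>set norm49. \<exists>w\<in>set norm49. row_mul w g = u \<or> row_mul w g = - u"
  by code_simp

lemma good_hex_group:
  assumes "good (app g v)" "g \<in> set hex_group"
  shows "good v"
  unfolding good_def
proof
  fix u assume "u \<in> set norm49"
  then obtain w where w: "w \<in> set norm49" "row_mul w g = u \<or> row_mul w g = - u"
    using hex_group_norm49 assms(2) by blast
  have "avoids (form (row_mul w g) v)"
    using assms(1) w(1) by (simp add: good_def form_row_mul)
  with w(2) show "avoids (form u v)" by (auto simp: form_uminus intro: avoids_uminus)
qed

text \<open>The orbit relation of the affine group formed by \<open>hex_group\<close> and the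
  integer translations. Letting \<open>g\<close> act on the representative \<open>r\<close> matches
  the direction of \<open>good_add_int\<close> and \<open>good_hex_group\<close>.\<close>

definition reduces :: "real \<times> real \<Rightarrow> real \<times> real \<Rightarrow> bool" where
  "reduces v r \<longleftrightarrow> (\<exists>g\<in>set hex_group. \<exists>m. v = app g r + int_pt m)"

lemma reduces_step:
  assumes "reduces v (app h r + int_pt n)" "h \<in> set hex_group"
  shows "reduces v r"
proof -
  obtain g m where g: "g \<in> set hex_group" "v = app g (app h r + int_pt n) + int_pt m"
    using assms(1) by (auto simp: reduces_def)
  obtain k where k: "app g (int_pt n) + int_pt m = int_pt k"
    by (metis app_int_pt int_pt_add)
  have "v = app (mat_mul g h) r + int_pt k"
    using g(2) k by (simp add: app_mat_mul app_add add.assoc)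
  thus ?thesis using g(1) assms(2) hex_group_mul unfolding reduces_def by blast
qed

lemma good_reduces: "reduces v r \<Longrightarrow> good v \<Longrightarrow> good r"
  unfolding reduces_def by (metis good_add_int good_hex_group)

text \<open>The three maps are involutions in the affine group, so each of them sends the new point
  back to \<open>(x, y)\<close>, as \<open>reduces_step\<close> requires.\<close>

lemma reduces_reflect:
  assumes "reduces v (x, y)"
  shows "reduces v (y, x)" "reduces v (1 - x, 1 - y)" "reduces v (1 - x - y, y)"
proof -
  show "reduces v (y, x)"
    by (rule reduces_step[where h = "(0,1,1,0)" and n = "(0,0)"])
      (use assms in \<open>simp_all add: hex_group_def\<close>)
  show "reduces v (1 - x, 1 - y)"
    by (rule reduces_step[where h = "(-1,0,0,-1)" and n = "(1,1)"])
      (use assms in \<open>simp_all add: hex_group_def\<close>)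
  show "reduces v (1 - x - y, y)"
    by (rule reduces_step[where h = "(-1,-1,0,1)" and n = "(1,0)"])
      (use assms in \<open>simp_all add: hex_group_def\<close>)
qed

text \<open>Successive folding of the unit square. The triangle has the vertices (0,0), (1/2,0),
  (1/3,1/3) and area 1/12, as befits a fundamental domain for 12 symmetries.\<close>

lemma reduces_to_triangle:
  "\<exists>x y. reduces v (x, y) \<and> 0 \<le> y \<and> y \<le> x \<and> 2 * x + y \<le> 1"
proof -
  obtain a b where v: "v = (a, b)" by fastforce
  have "reduces v (frac a, frac b)"
    unfolding reduces_def v
    by (rule bexI[of _ "(1,0,0,1)"], rule exI[of _ "(\<lfloor>a\<rfloor>, \<lfloor>b\<rfloor>)"])
      (simp_all add: frac_def hex_group_def)
  \<comment> \<open>If \<open>frac a + frac b\<close> exceeds 1, the point is reflected in the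
    centre of the square.\<close>
  then obtain x1 y1 where 1: "reduces v (x1, y1)" "0 \<le> x1" "0 \<le> y1" "x1 + y1 \<le> 1"
    using reduces_reflect(2)[of v "frac a" "frac b"] frac_ge_0[of a] frac_ge_0[of b]
      frac_lt_1[of a] frac_lt_1[of b]
    by (cases "frac a + frac b \<le> 1") force+
  then obtain x2 y2 where 2: "reduces v (x2, y2)" "0 \<le> y2" "y2 \<le> x2" "x2 + y2 \<le> 1"
    using reduces_reflect(1)[of v x1 y1] by (cases "y1 \<le> x1") force+
  show ?thesis
  proof (cases "2 * x2 + y2 \<le> 1")
    case False
    \<comment> \<open>This map fixes the line \<open>2 * x + y = 1\<close> pointwise and exchanges
      its two sides.\<close>
    have 3: "reduces v (1 - x2 - y2, y2)" using 2(1) by (rule reduces_reflect(3))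
    show ?thesis
    proof (cases "y2 \<le> 1 - x2 - y2")
      case True
      with 2 3 False show ?thesis by (intro exI[of _ "1 - x2 - y2"] exI[of _ y2]) auto
    next
      case False
      \<comment> \<open>The map broke \<open>y <= x\<close>, so the coordinates are swapped;
        \<open>2 * x + y <= 1\<close> then amounts to \<open>y2 <= x2\<close>.\<close>
      with 2 reduces_reflect(1)[OF 3] show ?thesis
        by (intro exI[of _ y2] exI[of _ "1 - x2 - y2"]) auto
    qed
  qed (use 2 in blast)
qed

section \<open>The five polygons\<close>

text \<open>The entry \<open>(a, b, e)\<close> stands for the inequality \<open>5 (a x + b y) \<le> e\<close>. The polygons lie at
  \<open>(1/3, 1/3)\<close>, \<open>(1/4, 1/4)\<close>, near \<open>(0.363, 0.174)\<close>, at \<open>(1/9, 1/9)\<close>, and near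
  \<open>(0.384, 0.078)\<close>.\<close>

definition regions :: "(int \<times> int \<times> int) list list" where
  "regions =
    [[(-5, -8, -21), (0, -7, -11), (2, 1, 5), (-1, 1, 0)],
     [(-5, -8, -16), (7, 0, 9), (8, 3, 14), (-1, 1, 0)],
     [(-5, -8, -16), (0, -7, -6), (8, 5, 19), (-3, 5, -1)],
     [(-3, -8, -6), (3, -5, -1), (7, 0, 4), (-1, 1, 0)],
     [(-7, -7, -16), (3, -5, 4), (3, 8, 9)]]"

definition in_region :: "nat \<Rightarrow> real \<times> real \<Rightarrow> bool" where
  "in_region j v \<longleftrightarrow> (\<forall>(a, b, e)\<in>set (regions ! j). 5 * form (a, b) v \<le> of_int e)"

definition has_kind :: "nat \<Rightarrow> real \<times> real \<Rightarrow> bool" where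
  "has_kind j v \<longleftrightarrow> (\<exists>r. reduces v r \<and> in_region j r)"

text \<open>Each instance of \<open>c\<close> removes a closed strip around a line on which a form
  takes an integer value. What the strips listed in \<open>splits\<close> leave of the triangle lies
  in the five polygons.\<close>

lemma triangle_cases:
  assumes "good (x, y)" "0 \<le> y" "y \<le> x" "2 * x + y \<le> 1"
  shows "\<exists>j\<in>{0, 1, 2, 3, 4}. in_region j (x, y)"
proof -
  have c: "5 * (of_int p * x + of_int q * y) < of_int (5 * m - 1) \<or>
      of_int (5 * m + 1) < 5 * (of_int p * x + of_int q * y)" if "(p, q) \<in> set norm49" for p q m
  proof -
    have "avoids (form (p, q) (x, y))" using assms(1) that unfolding good_def by blast
    from avoids_cases[OF this, of m] show ?thesis by simp
  qed
  note splits =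
    c[of 0 7 0] c[of 0 7 1] c[of 0 7 2] c[of 3 "-5" 0] c[of 3 "-5" 1] c[of 3 8 1] c[of 3 8 2]
    c[of 3 8 3] c[of 5 "-3" 1] c[of 5 "-3" 2] c[of 5 8 1] c[of 5 8 2] c[of 5 8 3] c[of 5 8 4]
    c[of 7 0 1] c[of 7 0 2] c[of 7 7 2] c[of 7 7 3] c[of 7 7 4] c[of 8 3 3] c[of 8 5 3]
    c[of 8 5 4]
  show ?thesis
    using assms(2-4) splits
    by (simp add: norm49_def in_region_def regions_def numeral_eq_Suc nth_Cons_Suc) argo
qed

lemma good_has_kind:
  assumes "good v"
  shows "\<exists>j\<in>{0, 1, 2, 3, 4}. has_kind j v"
proof -
  obtain x y where xy: "reduces v (x, y)" "0 \<le> y" "y \<le> x" "2 * x + y \<le> 1"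
    using reduces_to_triangle by blast
  have "good (x, y)" using xy(1) assms by (rule good_reduces)
  from triangle_cases[OF this xy(2-4)] xy(1) show ?thesis
    unfolding has_kind_def by blast
qed

section \<open>Certified case distinctions\<close>

text \<open>\<open>Split u m\<close> uses that the form \<open>u\<close> keeps a distance of more than 1/5 from \<open>m\<close>; \<open>Refute\<close>
  gives Farkas multipliers for the inequalities collected so far, the latest one coming first.
  The tuple \<open>(a, b, c, d, e)\<close> stands for \<open>5 (a x + b y + c x' + d y') \<le> e\<close>, or \<open><\<close>, where
  \<open>(x, y)\<close> and \<open>(x', y')\<close> are the first and the second point.\<close>

datatype cert = Refute "int list" | Split "int \<times> int" int cert cert

type_synonym ineq = "int \<times> int \<times> int \<times> int \<times> int"

fun lhs :: "real \<times> real \<Rightarrow> real \<times> real \<Rightarrow> ineq \<Rightarrow> real" where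
  "lhs v w (a, b, c, d, e) = 5 * (form (a, b) v + form (c, d) w)"

fun rhs :: "ineq \<Rightarrow> int" where
  "rhs (a, b, c, d, e) = e"

text \<open>Stops at the end of the shorter list, so certificates may omit trailing zero
  multipliers.\<close>

fun combine :: "int list \<Rightarrow> ineq list \<Rightarrow> ineq" where
  "combine (l # ls) ((a, b, c, d, e) # is) = (case combine ls is of
     (a', b', c', d', e') \<Rightarrow> (l * a + a', l * b + b', l * c + c', l * d + d', l * e + e'))"
| "combine _ _ = (0, 0, 0, 0, 0)"

lemma combine_le:
  assumes "\<forall>i\<in>set is. lhs v w i \<le> of_int (rhs i)" "list_all (\<lambda>l. 0 \<le> l) ls"
  shows "lhs v w (combine ls is) \<le> of_int (rhs (combine ls is))"
  using assms
proof (induction ls "is" rule: combine.induct)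
  case (1 l ls a b c d e "is")
  obtain a' b' c' d' e' where C: "combine ls is = (a', b', c', d', e')"
    by (cases "combine ls is") auto
  have "lhs v w (a', b', c', d', e') \<le> of_int e'"
    using 1 C by simp
  moreover have "of_int l * lhs v w (a, b, c, d, e) \<le> of_int l * of_int e"
    using 1 by (intro mult_left_mono) auto
  ultimately show ?case
    by (cases v; cases w) (simp add: C algebra_simps)
qed (cases v; cases w; simp)+

text \<open>A single strict inequality with a positive multiplier makes the sum strict, so the
  polygons may be given by weak inequalities.\<close>

lemma combine_less:
  assumes "lhs v w i < of_int (rhs i)" "\<forall>i\<in>set is. lhs v w i \<le> of_int (rhs i)"
    "0 < l" "list_all (\<lambda>l. 0 \<le> l) ls"
  shows "lhs v w (combine (l # ls) (i # is)) < of_int (rhs (combine (l # ls) (i # is)))"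
proof -
  obtain a b c d e where I: "i = (a, b, c, d, e)" by (cases i) auto
  obtain a' b' c' d' e' where C: "combine ls is = (a', b', c', d', e')"
    by (cases "combine ls is") auto
  have "lhs v w (a', b', c', d', e') \<le> of_int e'"
    using combine_le[OF assms(2,4)] C by simp
  moreover have "of_int l * lhs v w (a, b, c, d, e) < of_int l * of_int e"
    using assms(1,3) I by (intro mult_strict_left_mono) auto
  ultimately show ?thesis
    by (cases v; cases w) (simp add: C I algebra_simps)
qed

text \<open>\<open>ps\<close> collects the strict inequalities of the splits on the current path,
  \<open>rs\<close> the weak ones of the two polygons. A leaf must use the head of \<open>ps\<close>
  with a positive multiplier; the combination then reads \<open>0 < e\<close>, so
  \<open>e = 0\<close> is already absurd. The very first certificate below attains this
  equality.\<close>

fun check :: "mat \<Rightarrow> mat \<Rightarrow> ineq list \<Rightarrow> ineq list \<Rightarrow> cert \<Rightarrow> bool" where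
  "check A B ps rs (Refute ls) \<longleftrightarrow> (case (ps, ls) of
     (p # _, l # ls') \<Rightarrow> 0 < l \<and> list_all (\<lambda>l. 0 \<le> l) ls' \<and>
       (case combine ls (ps @ rs) of
         (a, b, c, d, e) \<Rightarrow> a = 0 \<and> b = 0 \<and> c = 0 \<and> d = 0 \<and> e \<le> 0)
   | _ \<Rightarrow> False)"
| "check A B ps rs (Split u m s t) \<longleftrightarrow> u \<in> set norm49 \<and>
     (case (row_mul u A, row_mul u B) of
       ((a, b), (c, d)) \<Rightarrow> check A B ((a, b, - c, - d, 5 * m - 1) # ps) rs s \<and>
         check A B ((- a, - b, c, d, - (5 * m + 1)) # ps) rs t)"

text \<open>Induction on the certificate: at a split, \<open>avoids_cases\<close> provides one of
  the two new strict inequalities; at a leaf, the Farkas combination is contradictory.\<close>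

lemma check_sound:
  assumes "check A B ps rs t" "good (app A v - app B w)"
    "\<forall>i\<in>set ps. lhs v w i < of_int (rhs i)" "\<forall>i\<in>set rs. lhs v w i \<le> of_int (rhs i)"
  shows False
  using assms(1,3)
proof (induction t arbitrary: ps)
  case (Refute ls)
  then obtain p ps' l ls' where ps: "ps = p # ps'" "ls = l # ls'"
    by (auto split: list.splits)
  obtain a b c d e where C: "combine ls (ps @ rs) = (a, b, c, d, e)"
    by (cases "combine ls (ps @ rs)") auto
  have z: "0 < l" "list_all (\<lambda>l. 0 \<le> l) ls'" "a = 0" "b = 0" "c = 0" "d = 0" "e \<le> 0"
    using Refute.prems(1) C by (simp_all add: ps)
  have "lhs v w (combine (l # ls') (p # ps' @ rs)) < of_int (rhs (combine (l # ls') (p # ps' @ rs)))"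
    using Refute.prems(2) assms(4) z(1,2) by (intro combine_less) (auto simp: ps less_imp_le)
  hence "lhs v w (a, b, c, d, e) < of_int e"
    using C by (simp add: ps)
  with z(3-7) show False by (cases v; cases w) simp
next
  case (Split u m s t)
  obtain a b where r: "row_mul u A = (a, b)" by fastforce
  obtain c d where q: "row_mul u B = (c, d)" by fastforce
  have eq: "form u (app A v - app B w) = form (a, b) v - form (c, d) w"
    by (simp only: form_diff form_row_mul[symmetric] r q)
  have "avoids (form u (app A v - app B w))"
    using assms(2) Split.prems(1) by (simp add: good_def)
  from avoids_cases[OF this, of m] show False
  proof
    assume "5 * form u (app A v - app B w) < of_int (5 * m - 1)"
    hence "\<forall>i\<in>set ((a, b, - c, - d, 5 * m - 1) # ps). lhs v w i < of_int (rhs i)"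
      using Split.prems(2) eq by (cases v; cases w) (simp add: algebra_simps)
    from Split.IH(1)[OF _ this] Split.prems(1) r q show False by simp
  next
    assume "of_int (5 * m + 1) < 5 * form u (app A v - app B w)"
    hence "\<forall>i\<in>set ((- a, - b, c, d, - (5 * m + 1)) # ps). lhs v w i < of_int (rhs i)"
      using Split.prems(2) eq by (cases v; cases w) (simp add: algebra_simps)
    from Split.IH(2)[OF _ this] Split.prems(1) r q show False by simp
  qed
qed

definition region_pair :: "nat \<Rightarrow> nat \<Rightarrow> ineq list" where
  "region_pair i j = map (\<lambda>(a, b, e). (a, b, 0, 0, e)) (regions ! i) @
     map (\<lambda>(a, b, e). (0, 0, a, b, e)) (regions ! j)"

lemma region_pair_le:
  assumes "in_region i v" "in_region j w"
  shows "\<forall>k\<in>set (region_pair i j). lhs v w k \<le> of_int (rhs k)"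
  using assms by (cases v; cases w) (fastforce simp: in_region_def region_pair_def)

text \<open>One certificate for each relative symmetry \<open>g\<close>: the first point stays in
  polygon \<open>i\<close>, the second one is the image under \<open>g\<close> of a point of polygon
  \<open>j\<close>.\<close>

definition excludes :: "mat \<Rightarrow> nat \<Rightarrow> nat \<Rightarrow> cert list \<Rightarrow> bool" where
  "excludes A i j ts \<longleftrightarrow>
     list_all2 (\<lambda>g t. check A (mat_mul A g) [] (region_pair i j) t) hex_group ts"

text \<open>Multiplication by \<open>\<surd>-3 = 1 + 2\<omega>\<close> and by 2 on frames.\<close>

definition moser_mat :: mat where "moser_mat = (1, 2, -2, -1)"

definition double_mat :: mat where "double_mat = (2, 0, 0, 2)"

text \<open>Rotations commute with both matrices. A reflection turns the square root of -3 into its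
  conjugate, that is its negative, and \<open>h\<close> absorbs the sign.\<close>

lemma hex_group_commute:
  "\<forall>A\<in>{moser_mat, double_mat}. \<forall>g\<in>set hex_group. \<exists>h\<in>set hex_group. mat_mul A g = mat_mul h A"
  by code_simp

text \<open>Modulo integer points, \<open>v\<close> is \<open>g r\<close> and \<open>w\<close> is
  \<open>g k s\<close>. Hence \<open>A (v - w)\<close> is \<open>l (A r - A k s)\<close>, and
  goodness is unaffected by \<open>l\<close> and by integer translations, so the certificate for
  \<open>k\<close> applies.\<close>

lemma excludes_sound:
  assumes "excludes A i j ts" "A \<in> {moser_mat, double_mat}"
    "has_kind i v" "has_kind j w" "good (app A (v - w))"
  shows False
proof -
  obtain r g m where r: "in_region i r" "g \<in> set hex_group" "v = app g r + int_pt m"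
    using assms(3) by (auto simp: has_kind_def reduces_def)
  obtain s h n where s: "in_region j s" "h \<in> set hex_group" "w = app h s + int_pt n"
    using assms(4) by (auto simp: has_kind_def reduces_def)
  obtain k where k: "k \<in> set hex_group" "h = mat_mul g k"
    using hex_group_quotient r(2) s(2) by blast
  obtain l where l: "l \<in> set hex_group" "mat_mul A g = mat_mul l A"
    using hex_group_commute assms(2) r(2) by blast
  have lA: "app A (app g x) = app l (app A x)" for x
    using l(2) by (metis app_mat_mul)
  obtain m' where m': "app A (int_pt m) = int_pt m'" using app_int_pt by blast
  obtain n' where n': "app A (int_pt n) = int_pt n'" using app_int_pt by blast
  have "app A (v - w) + int_pt n' = app l (app A r - app A (app k s)) + int_pt m'"
    using m' n' by (simp add: r(3) s(3) k(2) app_diff app_add app_mat_mul lA)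
  moreover obtain m'' where "int_pt m' = int_pt m'' + int_pt n'"
  proof
    show "int_pt m' = int_pt (m' - n') + int_pt n'"
      by (cases m'; cases n') simp
  qed
  ultimately have "app A (v - w) = app l (app A r - app A (app k s)) + int_pt m''"
    by (simp add: algebra_simps)
  with assms(5) have "good (app A r - app (mat_mul A k) s)"
    by (metis app_mat_mul good_add_int good_hex_group l(1))
  moreover obtain t where "check A (mat_mul A k) [] (region_pair i j) t"
    using assms(1) k(1) unfolding excludes_def
    by (metis in_set_conv_nth list_all2_conv_all_nth)
  ultimately show False
    using check_sound region_pair_le[OF r(1) s(1)] by fastforce
qed

text \<open>The outer list runs over the polygons of the second point, each inner list over
  \<open>hex_group\<close> in its order. Multipliers refer to the splits, newest first, then to the
  first and the second polygon.\<close>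

definition moser_certs_0 :: "cert list list" where
  "moser_certs_0 =
   [[Split (7,7) 0 (Refute [2,0,3,7,0,0,0,0,14]) (Refute [2,0,0,0,14,0,3,7]),
   Split (3,-5) 3 (Split (7,7) 7 (Refute [25,35,56,16,0,0,0,0,0,280]) (Refute
      [1,0,0,0,0,7,0,0,7])) (Split (7,0) 7 (Refute [49,91,0,15,420,0,105]) (Refute
      [2,0,0,0,14,14,0,3,7])),
   Split (0,7) (-7) (Refute [2,0,0,14,0,0,3,7]) (Split (3,8) (-2) (Refute
      [182,169,0,117,0,0,126,0,0,189]) (Refute [13,0,15,0,0,94,0,0,39,104])),
   Split (5,8) (-6) (Split (0,7) (-14) (Refute [1,0,0,0,7,0,0,0,7]) (Refute
      [11,14,0,15,0,0,0,15])) (Refute [13,9,0,0,98,9,0,0,98]),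
   Split (7,7) (-7) (Refute [2,0,3,7,0,0,0,14]) (Split (8,3) 2 (Refute
      [143,182,165,0,0,735,195]) (Refute [13,0,0,0,65,104,9,0,0,98])),
   Split (8,3) (-3) (Split (0,7) (-7) (Refute [1,0,0,0,7,0,0,0,0,7]) (Refute
      [15,35,56,16,0,0,0,0,280])) (Split (0,7) (-7) (Refute [1,0,0,0,7,0,0,0,0,7]) (Refute
      [25,35,0,0,0,280,56,16])),
   Split (3,-5) 0 (Split (7,7) 0 (Refute [25,35,56,16,0,0,0,0,280]) (Refute
      [1,0,0,0,0,7,0,0,0,7])) (Split (7,7) 0 (Refute [15,35,0,0,280,0,56,16]) (Refute
      [1,0,0,0,0,7,0,0,0,7])),
   Split (0,7) 0 (Split (3,-5) 3 (Refute [14,13,0,9,0,0,0,9]) (Refute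
      [13,0,0,0,104,39,15,0,0,94])) (Split (3,8) 3 (Refute [14,13,0,9,0,0,0,9]) (Refute
      [13,0,15,0,0,94,0,0,104,39])),
   Split (5,8) 2 (Split (0,7) (-7) (Refute [1,0,0,0,7,0,0,0,0,7]) (Refute
      [94,91,63,48,0,0,105])) (Refute [182,126,0,0,1372,0,117,1183]),
   Split (7,7) 0 (Refute [2,0,3,7,0,0,0,0,14]) (Refute [2,0,0,0,14,0,3,7]),
   Split (8,5) (-2) (Split (0,7) (-14) (Refute [1,0,0,0,7,0,0,0,7]) (Refute
      [25,35,56,16,0,0,0,0,0,280])) (Split (7,0) 7 (Refute [91,169,30,0,0,825,195]) (Refute
      [2,0,0,0,14,14,0,3,7])),
   Split (5,8) (-8) (Split (7,0) 0 (Refute [3,7,0,12,28,0,0,0,56]) (Refute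
      [5,7,0,0,56,0,0,12,28])) (Split (7,0) 0 (Refute [65,91,168,0,0,616,0,0,0,728]) (Refute
      [39,91,0,0,0,728,168,0,0,616]))],
   [Split (7,7) 0 (Refute [2,0,3,7,0,0,0,0,14]) (Refute [8,0,0,0,56,7,13]),
   Split (5,8) 3 (Split (7,7) 5 (Refute [26,0,0,39,91,0,42,0,0,154]) (Refute
      [20,28,0,0,84,0,21,3])) (Split (3,-5) 4 (Refute [143,0,264,0,0,539,0,0,195,1274]) (Refute
      [33,88,0,0,0,539,0,0,147,98])),
   Split (0,7) (-7) (Refute [8,0,0,56,0,7,13]) (Split (7,0) 12 (Refute
      [143,26,273,0,0,0,231,0,0,1029]) (Refute [11,11,0,0,0,77,0,0,21,91])),
   Split (7,0) 12 (Refute [20,28,8,0,0,35,5]) (Split (7,7) 0 (Refute [11,11,0,0,77,0,0,0,21,14])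
      (Refute [1,0,0,0,0,7,0,0,0,7])),
   Split (5,8) (-9) (Split (3,8) (-11) (Refute [154,0,0,99,1001,0,0,0,336,994]) (Refute
      [77,91,0,48,0,0,0,48])) (Refute [13,9,0,0,98,24,0,0,49]),
   Split (5,-3) 4 (Refute [273,504,0,0,483,0,299,182]) (Split (0,7) (-7) (Refute
      [1,0,0,0,7,0,0,0,0,7]) (Refute [32,28,0,0,0,140,35,5])),
   Split (8,3) 1 (Refute [105,42,147,0,0,0,115,70]) (Split (7,7) 0 (Refute
      [32,28,0,0,140,0,35,5]) (Refute [1,0,0,0,0,7,0,0,0,7])),
   Split (5,8) 3 (Split (7,7) 5 (Refute [4,0,0,6,14,0,7,1]) (Refute
      [65,91,0,0,273,0,63,0,0,231])) (Split (3,-5) 4 (Refute [273,0,504,0,0,1029,0,299,182])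
      (Refute [33,88,0,0,0,539,0,0,147,637])),
   Split (7,0) 12 (Refute [20,28,8,0,0,35,5]) (Split (0,7) (-7) (Refute [1,0,0,0,7,0,0,0,0,7])
      (Refute [11,11,0,0,0,77,0,0,21,14])),
   Split (7,7) 0 (Refute [2,0,3,7,0,0,0,0,14]) (Refute [8,0,0,0,56,7,13]),
   Split (3,8) (-11) (Refute [154,0,99,1001,0,0,0,336,686]) (Split (0,7) (-12) (Refute
      [20,28,0,0,0,84,21,3]) (Refute [13,0,21,0,0,77,21,0,0,77])),
   Split (0,7) (-7) (Refute [8,0,0,56,0,7,13]) (Split (3,8) (-7) (Refute
      [77,94,63,0,0,0,0,0,63,315]) (Refute [13,0,15,0,0,94,9,0,0,98]))],
   [Split (3,8) 0 (Refute [98,0,63,637,0,142,0,0,188]) (Split (3,-5) 1 (Refute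
      [715,0,1320,0,0,2695,0,0,1274,299]) (Split (7,0) 2 (Refute [39,56,35]) (Refute
      [13,0,7,0,0,56,112,0,24]))),
   Split (8,5) 8 (Split (7,0) 8 (Refute [35,0,49,14,0,0,10,0,0,65]) (Refute [8,7,0,0,35,0,7,2]))
      (Refute [8,0,0,24,64,0,7,13]),
   Split (5,8) 0 (Refute [70,0,75,385,0,28,98]) (Refute [715,495,0,0,5390,0,0,637,1222]),
   Split (3,8) (-10) (Split (5,8) (-7) (Refute [56,0,0,60,308,0,0,71,77]) (Refute
      [21,35,0,0,112,0,0,4,28])) (Refute [637,735,0,0,4606,923,0,0,1222]),
   Split (5,-3) 9 (Refute [52,96,0,0,92,0,91,13]) (Split (0,7) (-12) (Refute
      [5,0,0,0,35,0,0,0,7,7]) (Refute [56,49,0,0,0,245,65,0,0,55])),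
   Split (5,8) (-6) (Refute [770,0,825,4235,0,0,0,686,1316]) (Refute [65,45,0,0,490,26,91]),
   Split (3,8) (-2) (Refute [70,0,45,455,0,28,98]) (Refute [715,825,0,0,5170,0,0,637,1222]),
   Split (8,3) 6 (Refute [20,8,28,0,0,0,35,5]) (Split (7,7) 5 (Refute
      [56,49,0,0,245,0,65,0,0,55]) (Refute [5,0,0,0,0,35,0,0,7,7])),
   Split (5,8) 2 (Refute [98,0,105,539,0,142,0,0,188]) (Split (3,-5) 9 (Refute
      [52,0,96,0,0,196,0,91,13]) (Refute [12,32,0,0,0,196,0,7,49])),
   Split (3,8) (-8) (Refute [770,0,495,5005,0,0,0,686,1316]) (Refute [65,75,0,0,470,26,91]),
   Split (3,-5) 13 (Split (7,0) 8 (Refute [35,0,49,14,0,0,10,0,0,65]) (Refute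
      [8,7,0,0,0,35,7,2])) (Refute [8,0,0,64,24,0,7,13]),
   Split (5,8) (-8) (Split (8,5) (-4) (Refute [385,0,0,660,385,0,0,0,686,161]) (Split (7,0) 2
      (Refute [39,56,35]) (Refute [13,0,7,0,0,112,56,0,24]))) (Refute
      [637,441,0,0,4802,923,0,0,1222])],
   [Split (7,7) 0 (Refute [2,0,3,7,0,0,0,0,14]) (Refute [5,0,0,0,35,0,7,2]),
   Split (8,3) 6 (Split (7,7) 2 (Refute [22,0,0,33,77,0,42,0,0,182]) (Split (3,-5) 6 (Refute
      [7,0,7,21,0,0,0,0,0,6,105]) (Refute [5,7,8]))) (Refute [5,0,0,25,40,0,2,7]),
   Split (3,8) (-4) (Refute [546,0,351,3549,0,322,686]) (Refute [91,105,0,0,658,0,0,117,1001]),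
   Split (5,8) (-4) (Refute [70,0,75,385,0,0,28,98]) (Refute [143,99,0,0,1078,117,0,0,1222]),
   Split (5,-3) 9 (Split (0,7) (-9) (Split (8,5) 1 (Refute [11,0,2,0,21,0,0,0,0,21]) (Refute
      [5,7,8])) (Refute [143,0,231,0,0,847,273,0,0,182])) (Refute [7,0,0,56,35,0,0,9,77]),
   Split (3,8) (-6) (Refute [14,0,9,91,0,0,0,18,154]) (Refute [39,45,0,0,282,23,49]),
   Split (5,8) (-2) (Refute [546,0,585,3003,0,322,686]) (Refute [91,63,0,0,686,0,0,117,1001]),
   Split (8,3) 6 (Split (3,-5) 6 (Refute [143,26,294,0,0,441,0,0,273]) (Split (7,7) 2 (Refute
      [22,0,0,0,33,77,0,42,0,0,28]) (Refute [7,5,8]))) (Refute [7,0,0,35,56,0,0,9,77]),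
   Split (3,8) (-4) (Refute [154,0,99,1001,0,126,0,0,1316]) (Refute [65,75,0,0,470,0,26,91]),
   Split (7,7) 0 (Refute [2,0,3,7,0,0,0,0,14]) (Refute [5,0,0,0,35,0,7,2]),
   Split (5,-3) 9 (Split (8,3) 4 (Split (8,5) 1 (Refute [11,0,2,0,21,0,0,0,0,21,147]) (Refute
      [539,781,0,528,0,0,0,96,0,0,2352])) (Refute [88,55,0,0,0,429,117,0,0,78])) (Refute
      [5,0,0,40,25,0,2,7]),
   Split (3,8) (-6) (Refute [70,0,45,455,0,0,28,98]) (Refute [143,165,0,0,1034,117,0,0,1222])],
   [Split (0,7) (-1) (Refute [5,0,0,35,0,13,0,7]) (Split (7,0) 3 (Refute
      [195,0,273,78,0,0,0,70,385]) (Refute [39,39,0,0,0,273,0,77,14])),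
   Split (7,0) 9 (Split (0,7) (-3) (Refute [5,10,0,15,0,0,24,0,21]) (Refute
      [11,2,21,0,0,63,0,0,21])) (Split (7,7) 6 (Refute [8,8,0,0,56,0,11,7]) (Refute
      [3,0,0,0,0,21,0,7,7])),
   Split (5,-3) 13 (Split (8,5) 8 (Refute [11,2,0,21,0,0,21]) (Refute [26,13,6,0,0,165,0,0,39]))
      (Split (7,0) 13 (Refute [71,91,0,9,252,0,0,63]) (Refute [3,0,0,0,21,21,0,7,7])),
   Split (8,5) 3 (Split (0,7) (-13) (Refute [3,0,0,0,21,0,0,7,7]) (Refute
      [71,77,168,0,0,0,147,63])) (Refute [5,0,0,15,40,7,0,13]),
   Split (5,-3) 8 (Split (7,7) (-6) (Refute [23,91,168,0,0,0,0,168]) (Refute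
      [169,91,168,0,0,1344,312])) (Refute [5,0,0,40,25,7,0,13]),
   Split (8,3) (-1) (Split (7,7) (-4) (Refute [78,0,0,117,273,0,0,28,154]) (Refute
      [182,143,165,0,0,735,0,195])) (Split (7,0) 1 (Refute [40,56,0,0,0,168,33,21]) (Refute
      [5,0,0,0,35,35,13,0,7])),
   Split (5,-3) 2 (Split (0,7) (-3) (Refute [196,154,0,165,525,0,0,210]) (Refute
      [39,0,63,0,0,231,0,14,77])) (Split (7,0) 1 (Refute [196,182,0,99,315,0,0,126]) (Refute
      [5,0,0,0,35,35,13,0,7])),
   Split (0,7) (-1) (Refute [5,0,0,35,0,13,0,7]) (Split (3,8) 1 (Refute
      [455,490,189,144,0,0,0,315]) (Refute [39,0,45,0,0,282,0,71,98])),
   Split (3,-5) 8 (Split (7,7) 6 (Refute [49,91,168,0,0,0,117,105]) (Refute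
      [3,0,0,0,0,21,0,7,7])) (Refute [5,0,0,40,15,7,0,13]),
   Split (8,3) 10 (Split (7,7) 2 (Refute [10,0,0,15,35,0,22,0,28]) (Refute
      [143,182,210,0,0,315,195])) (Split (7,0) 13 (Refute [923,1183,126,0,0,3465,0,819]) (Refute
      [3,0,0,0,21,21,0,7,7])),
   Split (7,0) 9 (Split (8,5) 1 (Refute [35,0,0,60,35,0,23,0,77]) (Refute
      [182,143,105,0,0,840,195])) (Split (0,7) (-13) (Refute [3,0,0,0,21,0,0,7,7]) (Refute
      [8,8,0,0,0,56,11,7])),
   Split (7,7) (-6) (Split (7,0) 3 (Refute [195,0,273,78,0,0,0,70,385]) (Refute
      [39,39,0,0,273,0,0,77,14])) (Refute [5,0,0,0,35,13,0,7])]]"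

definition double_certs_1 :: "cert list list" where
  "double_certs_1 =
   [[Split (7,0) 0 (Refute [13,14,0,0,112,0,26]) (Refute [13,0,26,0,0,14,0,0,112]),
   Split (8,3) (-1) (Split (0,7) 7 (Refute [13,7,28,4,0,0,0,0,0,112]) (Refute
      [121,77,0,0,0,1232,0,0,336,224])) (Refute [1,0,0,2,0,2]),
   Split (5,8) 12 (Refute [13,26,0,0,0,22,0,0,98]) (Split (7,0) 0 (Refute
      [143,77,0,0,0,1232,0,0,336,1456]) (Refute [33,77,0,0,224,560,0,176])),
   Split (7,0) 7 (Refute [13,14,0,0,112,14,0,0,112]) (Refute [1,0,2,0,0,0,2]),
   Split (8,3) 12 (Refute [13,22,0,0,98,26]) (Split (0,7) 0 (Refute
      [33,77,0,176,0,0,0,0,224,560]) (Refute [143,77,0,0,336,1456,0,0,0,1232])),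
   Split (5,8) 1 (Refute [1,2,0,0,0,0,0,2]) (Split (7,0) 7 (Refute [13,7,0,0,0,112,28,4])
      (Refute [121,77,0,0,336,224,0,0,0,1232])),
   Split (7,7) 0 (Split (7,0) 0 (Refute [143,0,154,0,0,1232,0,0,182,1456]) (Refute
      [4,4,7,5,0,0,0,8])) (Split (7,0) 0 (Refute [2,1,0,0,0,14,0,0,0,14]) (Refute
      [33,55,0,0,182,224,154])),
   Split (8,3) (-1) (Split (0,7) 7 (Refute [65,91,224,0,0,336,0,208]) (Refute
      [121,77,0,0,0,1232,0,0,336,1456])) (Refute [1,0,0,2,0,2,0,0,6]),
   Split (7,0) 0 (Refute [13,14,0,0,112,0,26]) (Refute [13,0,26,0,0,14,0,0,112]),
   Split (3,-5) (-2) (Refute [308,0,0,112,2744,231,605]) (Refute [52,65,91,0,0,16,0,0,440]),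
   Split (0,7) 0 (Split (8,3) 12 (Refute [65,91,208,0,0,0,32,0,0,880]) (Refute
      [77,33,0,176,0,0,0,0,224,560])) (Split (8,3) 12 (Refute [7,11,0,0,0,112,28,4]) (Refute
      [77,55,0,0,224,560,0,176])),
   Split (7,0) 7 (Refute [13,14,0,0,112,14,0,0,112]) (Refute [1,0,2,0,0,0,2])],
   [Split (0,7) 1 (Refute [220,385,275,0,0,0,0,168,448]) (Refute [11,0,0,14,112,0,22]),
   Split (7,0) (-4) (Refute [715,770,0,0,6160,0,0,1456,546]) (Refute [7,0,14,0,0,16,0,0,6]),
   Split (7,0) 1 (Refute [715,770,0,0,6160,0,0,546,1456]) (Refute [1,0,2,0,0,0,2]),
   Split (5,8) 13 (Refute [1,2,0,0,0,2]) (Refute [55,0,0,130,490,0,0,98,78]),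
   Split (7,0) 11 (Refute [91,98,0,0,784,208,0,0,78]) (Refute [55,0,110,0,0,0,0,112,42]),
   Split (7,0) 6 (Refute [13,14,0,0,112,0,26]) (Refute [55,0,110,0,0,0,0,42,112]),
   Split (7,0) 1 (Refute [715,770,0,0,6160,0,0,546,1456]) (Refute [1,0,2,0,0,0,2]),
   Split (7,0) (-4) (Refute [715,770,0,0,6160,0,0,1456,546]) (Refute [7,0,14,0,0,16,0,0,6]),
   Split (0,7) 11 (Refute [28,49,35,0,0,64,0,0,24]) (Refute [55,0,0,70,560,0,0,112,42]),
   Split (7,0) 6 (Refute [13,14,0,0,112,0,26]) (Refute [55,0,110,0,0,0,0,42,112]),
   Split (7,0) 11 (Refute [91,98,0,0,784,208,0,0,78]) (Refute [55,0,110,0,0,0,0,112,42]),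
   Split (3,8) (-1) (Refute [385,770,220,0,0,0,0,686,546]) (Refute [1,0,0,2,10,2])],
   [Split (7,0) 2 (Refute [13,14,0,0,112,0,0,26]) (Refute [11,0,22,0,0,14,0,0,112]),
   Split (0,7) 5 (Refute [44,77,55,0,0,56,0,0,448]) (Refute [11,0,0,14,112,0,0,22]),
   Split (7,0) 2 (Refute [13,14,0,0,112,0,0,26,182]) (Refute [13,0,26,0,0,14,14]),
   Split (7,0) 5 (Refute [143,154,0,0,1232,182,0,0,1456]) (Refute [1,0,2,0,0,0,0,2]),
   Split (3,8) 5 (Refute [35,70,20,0,0,0,42,32]) (Refute [11,0,0,22,110,4,0,0,98]),
   Split (7,0) 5 (Refute [13,14,0,0,112,14,14]) (Refute [1,0,2,0,0,0,0,2,14]),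
   Split (7,0) 2 (Refute [13,14,0,0,112,0,0,26,182]) (Refute [13,0,26,0,0,14,14]),
   Split (0,7) 5 (Refute [52,91,65,0,0,56,56]) (Refute [11,0,0,14,112,0,0,22,154]),
   Split (7,0) 2 (Refute [13,14,0,0,112,0,0,26]) (Refute [11,0,22,0,0,14,0,0,112]),
   Split (7,0) 5 (Refute [13,14,0,0,112,14,14]) (Refute [1,0,2,0,0,0,0,2,14]),
   Split (3,8) 5 (Refute [7,14,4,0,0,0,0,4,70]) (Refute [1,0,0,2,10,0,2]),
   Split (7,0) 5 (Refute [143,154,0,0,1232,182,0,0,1456]) (Refute [1,0,2,0,0,0,0,2])],
   [Split (8,3) (-1) (Split (7,0) (-2) (Refute [39,0,42,0,0,336,0,112,70]) (Refute
      [55,56,42,12,0,0,0,0,42])) (Refute [7,0,0,14,0,22,0,14]),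
   Split (7,0) (-3) (Refute [39,42,0,0,336,0,70,112]) (Refute [1,0,2,0,0,2]),
   Split (3,-5) (-6) (Refute [429,0,0,156,3822,0,352,1078]) (Refute [4,5,7,0,0,7,3]),
   Split (3,8) 9 (Refute [28,56,16,0,0,39,35]) (Refute [1,0,0,2,10,0,0,2]),
   Split (5,8) 5 (Refute [1,2,0,0,0,0,2]) (Split (7,0) 10 (Refute [65,35,0,0,0,560,208,0,112])
      (Refute [429,385,0,0,1456,1792,0,0,1232])),
   Split (0,7) (-3) (Split (8,3) 4 (Refute [195,273,624,0,0,0,0,880,784]) (Refute
      [35,39,42,110,0,0,0,0,112])) (Refute [11,0,0,14,112,22]),
   Split (8,3) 2 (Refute [13,22,0,0,98,0,0,26]) (Refute [28,0,0,56,0,39,35]),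
   Split (7,0) (-3) (Refute [39,42,0,0,336,0,70,112]) (Refute [1,0,2,0,0,2]),
   Split (8,5) 5 (Refute [1,2,0,0,6,0,2]) (Split (0,7) 10 (Refute [25,35,0,80,0,0,128,0,112])
      (Refute [429,385,0,0,1456,5488,0,0,1232])),
   Split (8,3) 9 (Refute [364,616,0,0,2744,507,455]) (Refute [1,0,0,2,0,0,0,2]),
   Split (7,0) 10 (Refute [13,14,0,0,112,26]) (Split (3,8) 7 (Refute [35,39,70,98,0,0,0,0,112])
      (Refute [819,2145,0,0,4368,0,0,5488,6160])),
   Split (5,8) 3 (Refute [1,2,0,0,0,0,0,2]) (Refute [308,0,0,728,2744,429,385])]]"

definition double_certs_2 :: "cert list list" where
  "double_certs_2 =
   [[Split (0,7) (-1) (Refute [11,0,22,0,0,0,0,14,112]) (Refute [220,0,0,168,448,385,275]),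
   Split (0,7) 6 (Refute [13,0,26,0,0,14,0,0,112]) (Refute [55,0,0,42,112,0,110]),
   Split (7,7) 11 (Refute [91,208,0,0,78,98,0,0,784]) (Refute [55,0,0,112,42,0,110]),
   Split (5,8) 13 (Refute [1,2,0,0,0,2]) (Refute [55,0,0,98,78,0,0,130,490]),
   Split (0,7) (-1) (Refute [1,0,2,0,0,0,2]) (Refute [715,0,0,546,1456,770,0,0,6160]),
   Split (7,7) 4 (Refute [7,16,0,0,6,0,14]) (Refute [715,0,0,1456,546,770,0,0,6160]),
   Split (0,7) (-1) (Refute [1,0,2,0,0,0,2]) (Refute [715,0,0,546,1456,770,0,0,6160]),
   Split (7,7) 4 (Refute [7,16,0,0,6,0,14]) (Refute [715,0,0,1456,546,770,0,0,6160]),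
   Split (7,7) 11 (Refute [28,64,0,0,24,49,35]) (Refute [55,0,0,112,42,0,0,70,560]),
   Split (0,7) 6 (Refute [13,0,26,0,0,14,0,0,112]) (Refute [55,0,0,42,112,0,110]),
   Split (0,7) (-1) (Refute [11,0,22,0,0,0,0,14,112]) (Refute [220,0,0,168,448,385,275]),
   Split (3,-5) 7 (Refute [1,0,0,0,2,2,0,0,6]) (Refute [308,0,605,231,0,0,0,728,896])],
   [Split (7,0) 0 (Refute [28,40,0,0,64,0,35,49]) (Refute [28,0,35,49,0,40,0,0,64]),
   Split (7,7) 5 (Refute [385,880,0,0,330,0,0,294,784]) (Refute [55,0,0,112,42,0,110]),
   Split (0,7) 10 (Refute [7,0,14,0,0,16,0,0,6]) (Refute [55,0,0,42,112,0,0,112,42]),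
   Split (0,7) 5 (Refute [1,0,2,0,0,0,2]) (Refute [55,0,0,42,112,0,0,42,112]),
   Split (7,7) 10 (Refute [7,16,0,0,6,0,14]) (Refute [55,0,0,112,42,0,0,42,112]),
   Split (0,7) (-5) (Refute [55,0,110,0,0,0,0,112,42]) (Refute [385,0,0,294,784,880,0,0,330]),
   Split (7,7) 0 (Refute [385,880,0,0,330,0,0,784,294]) (Refute [385,0,0,784,294,880,0,0,330]),
   Split (0,7) 5 (Refute [1,0,2,0,0,0,2]) (Refute [55,0,0,42,112,0,0,42,112]),
   Split (7,0) 0 (Refute [28,40,0,0,64,0,35,49]) (Refute [28,0,35,49,0,40,0,0,64]),
   Split (7,7) 15 (Refute [7,16,0,0,6,16,0,0,6]) (Refute [55,0,0,112,42,0,0,112,42]),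
   Split (0,7) 0 (Refute [55,0,110,0,0,0,0,42,112]) (Refute [55,0,0,42,112,0,110]),
   Split (0,7) (-5) (Refute [55,0,110,0,0,0,0,112,42]) (Refute [385,0,0,294,784,880,0,0,330])],
   [Split (0,7) 1 (Refute [1,0,2,0,0,0,0,2,14]) (Refute [715,0,0,546,1456,770,770]),
   Split (7,0) 2 (Refute [7,10,0,0,16,0,0,28,98]) (Refute [44,0,55,77,0,112,0,0,280]),
   Split (7,7) 9 (Refute [77,176,0,0,66,98,0,0,784]) (Refute [55,0,0,112,42,0,0,110]),
   Split (0,7) 4 (Refute [13,0,26,0,0,14,14]) (Refute [55,0,0,42,112,0,0,110,770]),
   Split (0,7) 1 (Refute [1,0,2,0,0,0,0,2]) (Refute [55,0,0,42,112,70,0,0,560]),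
   Split (7,7) 6 (Refute [7,16,0,0,6,0,0,14]) (Refute [55,0,0,112,42,70,0,0,560]),
   Split (0,7) 1 (Refute [1,0,2,0,0,0,0,2]) (Refute [55,0,0,42,112,70,0,0,560]),
   Split (7,0) 2 (Refute [7,10,0,0,16,0,0,28,98]) (Refute [44,0,55,77,0,112,0,0,280]),
   Split (7,7) 9 (Refute [91,208,0,0,78,98,98]) (Refute [55,0,0,112,42,0,0,110,770]),
   Split (0,7) 4 (Refute [11,0,22,0,0,14,0,0,112]) (Refute [55,0,0,42,112,0,0,110]),
   Split (0,7) 1 (Refute [1,0,2,0,0,0,0,2,14]) (Refute [715,0,0,546,1456,770,770]),
   Split (7,7) 6 (Refute [7,16,0,0,6,0,0,14,98]) (Refute [715,0,0,1456,546,770,770])],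
   [Split (7,7) 1 (Refute [273,624,0,0,234,0,490,784]) (Refute [55,0,0,112,42,110]),
   Split (8,5) 4 (Refute [49,110,0,0,78,0,0,98]) (Refute [28,0,0,56,0,39,35]),
   Split (7,0) 4 (Refute [35,50,0,0,80,42,0,98]) (Refute [4,0,5,7,0,3,7]),
   Split (7,7) 14 (Refute [7,16,0,0,6,14]) (Refute [2145,0,0,4368,1638,0,3850,6160]),
   Split (8,3) 12 (Refute [4,8,0,0,8,7,3]) (Refute [273,0,156,546,0,0,224,686]),
   Split (0,7) (-4) (Split (7,7) 2 (Refute [273,0,624,0,0,234,0,784,490]) (Refute
      [20,32,0,49,35,0,0,0,56])) (Refute [55,0,0,42,112,110]),
   Split (7,0) 4 (Refute [35,50,0,0,80,42,0,98]) (Refute [4,0,5,7,0,3,7]),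
   Split (3,-5) (-3) (Refute [1,0,0,0,2,0,0,2]) (Refute [28,0,55,21,0,39,35]),
   Split (0,7) 9 (Refute [1,0,2,0,0,2]) (Refute [2145,0,0,1638,4368,0,3850,6160]),
   Split (7,7) 14 (Refute [7,16,0,0,6,14]) (Refute [2145,0,0,4368,1638,0,3850,6160]),
   Split (3,-5) 4 (Refute [28,0,0,0,56,39,35]) (Refute [28,0,55,21,0,0,0,56]),
   Split (5,8) 3 (Refute [1,2,0,0,0,0,0,2]) (Refute [1540,0,0,2744,2184,2145,1925])]]"

definition double_certs_3 :: "cert list list" where
  "double_certs_3 =
   [[Split (7,0) 0 (Refute [11,14,0,0,112,0,0,22]) (Refute [11,0,0,22,0,14,0,0,112]),
   Split (0,7) 3 (Refute [143,154,154,0,0,182,0,0,1456]) (Refute [1,0,0,2,14,0,0,2]),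
   Split (7,0) 0 (Refute [11,14,0,0,112,0,0,22,154]) (Refute [13,0,0,26,0,14,14]),
   Split (7,0) 3 (Refute [11,14,0,0,112,14,0,0,112]) (Refute [1,0,0,2,0,0,0,2]),
   Split (0,7) 0 (Refute [13,14,14,0,0,0,0,26]) (Refute [11,0,0,22,154,14,0,0,112]),
   Split (7,0) 3 (Refute [143,182,0,0,1456,154,154]) (Refute [1,0,0,2,0,0,0,2,14]),
   Split (7,0) 0 (Refute [11,14,0,0,112,0,0,22,154]) (Refute [13,0,0,26,0,14,14]),
   Split (0,7) 3 (Refute [13,14,14,0,0,14,14]) (Refute [1,0,0,2,14,0,0,2,14]),
   Split (7,0) 0 (Refute [11,14,0,0,112,0,0,22]) (Refute [11,0,0,22,0,14,0,0,112]),
   Split (7,0) 3 (Refute [143,182,0,0,1456,154,154]) (Refute [1,0,0,2,0,0,0,2,14]),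
   Split (0,7) 0 (Refute [13,14,14,0,0,0,0,26,182]) (Refute [13,0,0,26,182,14,14]),
   Split (7,0) 3 (Refute [11,14,0,0,112,14,0,0,112]) (Refute [1,0,0,2,0,0,0,2])],
   [Split (3,8) (-1) (Refute [1,2,0,0,0,0,0,2]) (Refute [28,0,0,88,448,39,35]),
   Split (7,0) (-5) (Refute [429,546,0,0,4368,0,770,1232]) (Refute [1,0,0,2,0,2]),
   Split (5,-3) (-3) (Refute [11,4,0,0,98,0,0,22]) (Refute [140,0,168,128,0,195,175]),
   Split (3,-5) 1 (Refute [35,0,0,20,350,78,0,112]) (Refute [1,0,2,0,0,0,2]),
   Split (7,0) 8 (Refute [11,14,0,0,112,22]) (Split (0,7) (-4) (Refute
      [39,0,42,42,0,0,0,112,70]) (Refute [5,8,0,0,26,70,0,0,14])),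
   Split (0,7) (-5) (Refute [39,42,42,0,0,0,70,112]) (Refute [1,0,0,2,14,2]),
   Split (8,3) (-1) (Refute [1,2,0,0,10,0,0,2]) (Refute [28,0,0,88,168,39,35]),
   Split (7,0) (-5) (Refute [429,546,0,0,4368,0,770,1232]) (Refute [1,0,0,2,0,2]),
   Split (0,7) 8 (Refute [13,14,14,0,0,26]) (Split (7,0) (-4) (Refute
      [429,0,546,0,0,4368,0,1232,770]) (Refute [5,8,0,0,26,112,0,0,14])),
   Split (8,3) 6 (Refute [28,56,0,0,280,39,35]) (Refute [7,0,0,22,42,0,0,14]),
   Split (3,-5) 3 (Refute [28,0,0,16,280,39,35]) (Refute [1,0,2,0,0,0,0,2]),
   Split (0,7) (-5) (Refute [39,42,42,0,0,0,70,112]) (Refute [1,0,0,2,14,2])]]"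

definition moser_certs_4 :: "cert list list" where
  "moser_certs_4 =
   [[Split (7,0) 0 (Refute [312,429,273,0,0,112,616]) (Refute [312,0,112,616,429,273]),
   Split (3,-5) 4 (Refute [35,71,0,14,23,0,77]) (Split (7,0) 6 (Refute [143,182,0,280,175,195])
      (Refute [39,0,0,14,77,0,77,14])),
   Split (3,8) (-5) (Split (3,-5) 10 (Refute [56,56,27,63,0,72]) (Refute
      [39,0,0,71,98,0,94,49])) (Refute [5,14,0,11,7,0,13]),
   Split (5,8) (-8) (Split (0,7) (-12) (Refute [3,0,0,7,7,0,7,7]) (Refute [7,13,0,15,0,0,15]))
      (Refute [35,94,0,91,94,0,91]),
   Split (8,5) (-5) (Split (5,8) (-10) (Refute [39,0,0,94,49,0,71,98]) (Refute
      [56,56,72,0,0,27,63])) (Refute [5,7,0,13,14,0,11]),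
   Split (8,3) (-4) (Split (7,7) (-6) (Refute [39,0,0,77,14,0,14,77]) (Refute
      [143,182,195,0,0,0,280,175])) (Refute [35,23,0,77,71,0,14]),
   Split (8,5) (-4) (Refute [2184,897,3549,0,0,5264,2744]) (Split (7,0) (-2) (Refute
      [94,91,165,0,105,0,0,105]) (Refute [195,0,0,70,385,507,0,273])),
   Split (0,7) 0 (Split (3,-5) 1 (Refute [728,784,0,504,0,351,315]) (Refute
      [195,0,0,355,490,546,0,429])) (Split (3,8) 1 (Refute [728,784,351,315,0,0,504]) (Refute
      [195,0,546,0,429,0,355,490])),
   Split (8,3) 7 (Refute [56,49,77,0,94,14]) (Split (7,7) 4 (Refute [91,169,0,80,245,0,0,195])
      (Refute [15,0,33,0,42,0,35,35])),
   Split (7,7) 0 (Split (3,-5) 11 (Refute [7,1,12,0,0,12]) (Refute [143,91,0,440,392,0,0,312]))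
      (Split (3,-5) 11 (Refute [140,0,284,0,56,235,35]) (Refute
      [1001,923,0,0,2184,0,3080,2744])),
   Split (3,8) (-11) (Split (7,0) 6 (Refute [71,77,0,168,0,0,0,168]) (Refute
      [39,0,0,14,77,0,77,14])) (Split (5,8) (-9) (Refute [385,455,240,0,0,384,0,336]) (Refute
      [140,0,376,0,364,235,35])),
   Split (7,0) 0 (Refute [312,429,273,0,0,112,616]) (Refute [312,0,112,616,429,273])]]"

text \<open>Polygons already eliminated no longer occur as partners: 0 is tested against all five, 1
  and 2 against 1 to 4, then 3 against 3 and 4, and finally 4 against itself.\<close>

lemma certs_valid:
  "list_all2 (\<lambda>j. excludes moser_mat 0 j) [0, 1, 2, 3, 4] moser_certs_0"
  "list_all2 (\<lambda>j. excludes double_mat 1 j) [1, 2, 3, 4] double_certs_1"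
  "list_all2 (\<lambda>j. excludes double_mat 2 j) [1, 2, 3, 4] double_certs_2"
  "list_all2 (\<lambda>j. excludes double_mat 3 j) [3, 4] double_certs_3"
  "list_all2 (\<lambda>j. excludes moser_mat 4 j) [4] moser_certs_4"
  by code_simp+

section \<open>Frames\<close>

definition omega :: complex where
  "omega = Complex (- 1 / 2) (sqrt 3 / 2)"

fun eis :: "int \<times> int \<Rightarrow> complex" where
  "eis (p, q) = of_int p + of_int q * omega"

lemma omega_square: "omega * omega = - 1 - omega"
  by (simp add: omega_def complex_eq_iff)

lemma norm_eis: "(cmod (eis (p, q)))\<^sup>2 = of_int (p * p - p * q + q * q)"
  unfolding cmod_power2 by (simp add: omega_def power2_eq_square algebra_simps)

lemma norm_norm49: "u \<in> set norm49 \<Longrightarrow> cmod (eis u / 7) = 1"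
proof -
  assume "u \<in> set norm49"
  hence "(cmod (eis u))\<^sup>2 = 7\<^sup>2"
    by (cases u) (auto simp: norm49_def norm_eis simp del: eis.simps)
  hence "cmod (eis u) = 7"
    by (metis norm_ge_zero power2_eq_imp_eq zero_le_numeral)
  thus ?thesis by (simp add: norm_divide)
qed

text \<open>\<open>Re (z * cnj v)\<close> is the scalar product of \<open>z\<close> and
  \<open>v\<close>. The factor 1/7 turns the elements of norm 49 into unit vectors.\<close>

definition frame :: "complex \<Rightarrow> complex \<Rightarrow> real \<times> real" where
  "frame z u = (Re (z * cnj u) / 7, Re (z * cnj (omega * u)) / 7)"

lemma form_frame: "form u (frame z v) = Re (z * cnj (eis u / 7 * v))"
  by (cases u) (simp add: frame_def algebra_simps add_divide_distrib diff_divide_distrib)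

lemma frame_diff: "frame z (u - v) = frame z u - frame z v"
  by (simp add: frame_def right_diff_distrib diff_divide_distrib del: times_complex.sel)

text \<open>The second row comes from
  \<open>omega * (p + q * omega) = - q + (p - q) * omega\<close>.\<close>

lemma frame_eis: "frame z (eis (p, q) * u) = app (p, q, - q, p - q) (frame z u)"
proof -
  have scale: "Re (z * cnj (of_int k * w)) = of_int k * Re (z * cnj w)" for k w
    by (simp add: algebra_simps)
  have "omega * (eis (p, q) * u) = of_int p * (omega * u) + of_int q * (omega * omega) * u"
    by (simp add: algebra_simps)
  also have "\<dots> = of_int (p - q) * (omega * u) - of_int q * u"
    by (simp add: omega_square algebra_simps)
  finally have 2: "omega * (eis (p, q) * u) = of_int (p - q) * (omega * u) - of_int q * u" .
  have 1: "eis (p, q) * u = of_int p * u + of_int q * (omega * u)"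
    by (simp add: algebra_simps)
  have "Re (z * cnj (eis (p, q) * u)) =
      of_int p * Re (z * cnj u) + of_int q * Re (z * cnj (omega * u))"
    unfolding 1 complex_cnj_add distrib_left plus_complex.sel scale ..
  moreover have "Re (z * cnj (omega * (eis (p, q) * u))) =
      of_int (p - q) * Re (z * cnj (omega * u)) - of_int q * Re (z * cnj u)"
    unfolding 2 complex_cnj_diff right_diff_distrib minus_complex.sel scale ..
  ultimately show ?thesis
    by (simp add: frame_def add_divide_distrib diff_divide_distrib del: times_complex.sel eis.simps)
qed

text \<open>\<open>1\<close>, \<open>moser_rot\<close> and \<open>0\<close> span an isosceles triangle with base \<open>1/\<surd>3\<close>, and \<open>1\<close>,
  \<open>double_rot\<close> and \<open>0\<close> one with base \<open>1/2\<close>.\<close>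

definition moser_rot :: complex where "moser_rot = Complex (5 / 6) (sqrt 11 / 6)"
definition moser_third :: complex where "moser_third = Complex (sqrt 33 / 6) (sqrt 3 / 6)"
definition double_rot :: complex where "double_rot = Complex (7 / 8) (sqrt 15 / 8)"
definition double_third :: complex where "double_third = Complex (1 / 4) (- sqrt 15 / 4)"

lemma norm_rotations:
  "cmod moser_rot = 1" "cmod moser_third = 1" "cmod double_rot = 1" "cmod double_third = 1"
  by (simp_all add: cmod_def moser_rot_def moser_third_def double_rot_def double_third_def
      power_divide)

text \<open>\<open>1 + 2 * omega\<close> is the square root of -3. It stretches the base of the
  isosceles triangle to length 1, so \<open>moser_third\<close> is a unit vector.\<close>

lemma frame_moser_third:
  "frame z (moser_third * u) = app moser_mat (frame z u - frame z (moser_rot * u))"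
proof -
  have "sqrt 33 = sqrt 3 * sqrt 11" by (simp flip: real_sqrt_mult)
  hence "moser_third = eis (1, 2) * (1 - moser_rot)"
    by (simp add: moser_third_def moser_rot_def omega_def complex_eq_iff)
  hence "moser_third * u = eis (1, 2) * (u - moser_rot * u)"
    by (metis left_diff_distrib mult.assoc mult_1)
  thus ?thesis by (simp only: frame_eis frame_diff moser_mat_def) simp
qed

lemma frame_double_third:
  "frame z (double_third * u) = app double_mat (frame z u - frame z (double_rot * u))"
proof -
  have "double_third = eis (2, 0) * (1 - double_rot)"
    by (simp add: double_third_def double_rot_def complex_eq_iff)
  hence "double_third * u = eis (2, 0) * (u - double_rot * u)"
    by (metis left_diff_distrib mult.assoc mult_1)
  thus ?thesis by (simp only: frame_eis frame_diff double_mat_def) simp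
qed

section \<open>Elimination of the polygons, one after the other\<close>

lemma moser_excludes_0:
  assumes "\<forall>v\<in>{u, moser_rot * u, moser_third * u}. good (frame z v)"
  shows "\<not> has_kind 0 (frame z u)"
proof
  assume k: "has_kind 0 (frame z u)"
  have "good (app moser_mat (frame z u - frame z (moser_rot * u)))"
    using assms by (simp add: frame_moser_third)
  note excl = excludes_sound[OF _ _ k _ this, simplified]
  obtain j where "j \<in> {0, 1, 2, 3, 4}" "has_kind j (frame z (moser_rot * u))"
    using good_has_kind assms by blast
  moreover obtain ts where "excludes moser_mat 0 j ts" if "j \<in> {0, 1, 2, 3, 4}"
    using certs_valid(1) by (auto simp: list_all2_Cons1)
  ultimately show False using excl by blast
qed

text \<open>Goodness on \<open>frames1 u\<close>, \<open>frames2 u\<close>, \<open>frames3 u\<close>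
  leaves for the frame of \<open>u\<close> the kinds 1 to 4, the kinds 3 and 4, and kind 4 only; on
  \<open>frames4\<close> it is impossible. Each later level contains the previous one for a vector
  and for its rotation, which restricts both points of a certificate, together with the third
  vector.\<close>

definition frames1 :: "complex \<Rightarrow> complex set" where
  "frames1 u = {u, moser_rot * u, moser_third * u}"

definition frames2 :: "complex \<Rightarrow> complex set" where
  "frames2 u = insert (double_third * u) (frames1 u \<union> frames1 (double_rot * u))"

definition frames3 :: "complex \<Rightarrow> complex set" where
  "frames3 u = frames2 u \<union> frames2 (double_rot * u)"

definition frames4 :: "complex set" where
  "frames4 = insert moser_third (frames3 1 \<union> frames3 moser_rot)"

lemma kind_frames1:
  assumes "\<forall>v\<in>frames1 u. good (frame z v)"
  shows "\<exists>j\<in>{1, 2, 3, 4}. has_kind j (frame z u)"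
  using good_has_kind[of "frame z u"] moser_excludes_0[of u z] assms
  by (auto simp: frames1_def)

lemma double_excludes:
  assumes "list_all2 (\<lambda>j. excludes double_mat i j) js tss" "j \<in> set js"
    "has_kind i (frame z u)" "has_kind j (frame z (double_rot * u))"
    "good (frame z (double_third * u))"
  shows False
proof -
  obtain ts where "excludes double_mat i j ts"
    using assms(1,2) by (metis in_set_conv_nth list_all2_conv_all_nth)
  from excludes_sound[OF this _ assms(3,4)] assms(5) show False
    by (simp add: frame_double_third)
qed

lemma kind_frames2:
  assumes "\<forall>v\<in>frames2 u. good (frame z v)"
  shows "\<exists>j\<in>{3, 4}. has_kind j (frame z u)"
proof -
  have g: "good (frame z (double_third * u))" using assms by (simp add: frames2_def)
  obtain i where i: "i \<in> {1, 2, 3, 4}" "has_kind i (frame z u)"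
    using kind_frames1[of u z] assms by (auto simp: frames2_def)
  obtain j where j: "j \<in> set [1, 2, 3, 4]" "has_kind j (frame z (double_rot * u))"
    using kind_frames1[of "double_rot * u" z] assms by (auto simp: frames2_def)
  show ?thesis
    using i double_excludes[OF certs_valid(2) j(1) _ j(2) g]
      double_excludes[OF certs_valid(3) j(1) _ j(2) g] by blast
qed

lemma kind_frames3:
  assumes "\<forall>v\<in>frames3 u. good (frame z v)"
  shows "has_kind 4 (frame z u)"
proof -
  have g: "good (frame z (double_third * u))" using assms by (simp add: frames3_def frames2_def)
  obtain i where i: "i \<in> {3, 4}" "has_kind i (frame z u)"
    using kind_frames2[of u z] assms by (auto simp: frames3_def)
  obtain j where j: "j \<in> set [3, 4]" "has_kind j (frame z (double_rot * u))"
    using kind_frames2[of "double_rot * u" z] assms by (auto simp: frames3_def)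
  show ?thesis
    using i double_excludes[OF certs_valid(4) j(1) _ j(2) g] by blast
qed

lemma not_all_frames_good: "\<exists>v\<in>frames4. \<not> good (frame z v)"
proof (rule ccontr)
  assume "\<not> ?thesis"
  hence g: "\<forall>v\<in>frames4. good (frame z v)" by blast
  have "has_kind 4 (frame z 1)" "has_kind 4 (frame z moser_rot)"
    using g by (auto simp: frames4_def intro!: kind_frames3)
  moreover have "good (app moser_mat (frame z 1 - frame z moser_rot))"
    using g frame_moser_third[of z 1] by (simp add: frames4_def)
  moreover obtain ts where "excludes moser_mat 4 4 ts"
    using certs_valid(5) by (auto simp: list_all2_Cons1)
  ultimately show False using excludes_sound by blast
qed

section \<open>The covering by rotated strips\<close>

text \<open>Rotating \<open>(x, y)\<close> back by \<open>Arg v\<close> gives a point whose first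
  coordinate is the scalar product with \<open>v\<close>; \<open>c\<close> and \<open>s\<close> are
  the coordinates of \<open>v\<close>.\<close>

lemma mem_rotation_strips:
  assumes "cmod v = 1" "dist_nearest_int (Re (Complex x y * cnj v)) \<le> \<epsilon>"
  shows "(x, y) \<in> rotation (Arg v) ` strips \<epsilon>"
proof -
  have v: "v = Complex (cos (Arg v)) (sin (Arg v))"
    using rcis_cmod_Arg[of v] assms(1) by (simp add: rcis_def cis.ctr)
  define c s where "c = cos (Arg v)" "s = sin (Arg v)"
  have "c * c + s * s = 1"
    using sin_cos_squared_add3 by (simp add: c_s_def)
  hence "c * (c * x + s * y) - s * (c * y - s * x) = x"
    "s * (c * x + s * y) + c * (c * y - s * x) = y" by algebra+
  hence "(x, y) = rotation (Arg v) (c * x + s * y, c * y - s * x)"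
    by (simp add: rotation_def c_s_def)
  moreover have "Re (Complex x y * cnj v) = c * x + s * y"
    by (subst v) (simp add: c_s_def)
  hence "(c * x + s * y, c * y - s * x) \<in> strips \<epsilon>"
    using assms(2) by (simp add: strips_def)
  ultimately show ?thesis by blast
qed

lemma finite_rotation_propertyI:
  assumes "finite V" "\<And>v. v \<in> V \<Longrightarrow> cmod v = 1"
    "\<And>z. \<exists>v\<in>V. dist_nearest_int (Re (z * cnj v)) \<le> \<epsilon>"
  shows "finite_rotation_property \<epsilon>"
proof -
  obtain n and f :: "nat \<Rightarrow> complex" where f: "V = f ` {i. i < n}"
    using finite_imp_nat_seg_image_inj_on[OF assms(1)] by blast
  have "p \<in> (\<Union>j\<in>{0..n}. rotation (Arg (f j)) ` strips \<epsilon>)" for p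
  proof -
    obtain x y where p: "p = (x, y)" by fastforce
    obtain v where v: "v \<in> V" "dist_nearest_int (Re (Complex x y * cnj v)) \<le> \<epsilon>"
      using assms(3) by blast
    then obtain j where "j < n" "v = f j" using f by blast
    with mem_rotation_strips[OF assms(2)[OF v(1)] v(2)] show ?thesis
      by (auto simp: p intro!: bexI[of _ j])
  qed
  thus ?thesis
    \<comment> \<open>\<open>V\<close> is the image of the indices below \<open>n\<close>, while the
      union also runs over \<open>n\<close>; the extra rotated copy does no harm.\<close>
    unfolding finite_rotation_property_def by (intro exI[of _ n] exI[of _ "\<lambda>j. Arg (f j)"]) blast
qed

lemma norm_frames4: "v \<in> frames4 \<Longrightarrow> cmod v = 1"
  by (auto simp: frames4_def frames3_def frames2_def frames1_def norm_mult norm_rotations)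

text \<open>A frame that is not good has a form within 1/5 of an integer, and by
  \<open>form_frame\<close> this form is the scalar product of \<open>z\<close> with one of the
  vectors in \<open>?V\<close>.\<close>

lemma finite_rotation_property_one_fifth: "finite_rotation_property (1 / 5)"
proof (rule finite_rotation_propertyI)
  let ?V = "(\<lambda>(u, v). eis u / 7 * v) ` (set norm49 \<times> frames4)"
  show "finite ?V" by (simp add: frames4_def frames3_def frames2_def frames1_def)
  show "cmod w = 1" if "w \<in> ?V" for w
  proof -
    from that obtain u v where w: "w = eis u / 7 * v" "u \<in> set norm49" "v \<in> frames4" by auto
    thus ?thesis by (simp only: norm_mult norm_norm49 norm_frames4 mult_1)
  qed
  show "\<exists>w\<in>?V. dist_nearest_int (Re (z * cnj w)) \<le> 1 / 5" for z
  proof -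
    obtain u v where "v \<in> frames4" "u \<in> set norm49" "\<not> avoids (form u (frame z v))"
      using not_all_frames_good[of z] by (auto simp: good_def)
    thus ?thesis
      by (intro bexI[of _ "eis u / 7 * v"]) (auto simp: avoids_def form_frame simp del: eis.simps)
  qed
qed

theorem corollary4p5:
  shows "epsilon0 \<le> 1 / 5"
  unfolding epsilon0_def
proof (rule cInf_lower)
  show "1 / 5 \<in> {\<epsilon>. 0 < \<epsilon> \<and> finite_rotation_property \<epsilon>}"
    using finite_rotation_property_one_fifth by simp
  show "bdd_below {\<epsilon>. 0 < \<epsilon> \<and> finite_rotation_property \<epsilon>}"
    by (rule bdd_belowI[of _ 0]) auto
qed
end
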